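(* For every $r\in(0,\tfrac12]$ there is a constant $c_r>0$ such that the following holds. For every integer $N\ge 2$ and every ORN design on $N$ nodes that guarantees throughput $r$, the maximum latency $L_{\max}$ of the design satisfies \[ L_{\max}\;\ge\; c_r\, h\left[(\varepsilon N)^{1/h}+N^{1/(h+1)}\right] \;=\; c_r\,L^*(r,N), \] where $h=\lfloor \frac{1}{2r}\rfloor$ and $\varepsilon=h+1-\frac{1}{2r}$.
   Context: Nodes are $[N]=\{1,\dots,N\}$. A connection schedule of size $N$ and period $T\ge1$ is a sequence of permutations $\pi_0,\dots,\pi_{T-1}$ of $[N]$; write $\pi_t=\pi_{t \bmod T}$ for all $t\in\mathbb Z$. Its virtual topology is the directed graph $G$ with vertex set $[N]\times\mathbb Z$ whose edges are the virtual edges $(i,t)\to(i,t+1)$ and the physical edges $(i,t)\to(\pi_t(i),t+1)$, for all $i\in[N]$, $t\in\mathbb Z$. The latency of a finite directed path in $G$ is its number of edges. For $a,b\in[N]$, $t\in\mathbb Z$, $\mathcal P(a,b,t)$ is the set of paths in $G$ from $(a,t)$ to some vertex $(b,t')$, and $\mathcal P$ is the set of all paths. A flow is a function $f:\mathcal P\to[0,\infty)$; the load on an edge $e$ is $F(f,e)=\sum_{P\ni e}f(P)$; $f$ is feasible if $F(f,e)\le 1$ for every physical edge $e$. An oblivious routing scheme $R$ assigns to each $(a,b,t)\in[N]\times[N]\times\mathbb Z$ a flow $R_{a,b,t}$ supported on $\mathcal P(a,b,t)$ with $\sum_P R_{a,b,t}(P)=1$, which is periodic: $R_{a,b,t+T}$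 is obtained from $R_{a,b,t}$ by shifting every path by $T$ in the time coordinate. An ORN design on $N$ nodes is a connection schedule together with an oblivious routing scheme on its virtual topology; its maximum latency is the maximum latency of a path $P$ with $R_{a,b,t}(P)>0$ for some $a,b,t$. A demand function $D$ assigns to each $t\in\mathbb Z$ an $N\times N$ matrix $D(t)$ with nonnegative entries $D(t,a,b)$; it requests throughput equal to the supremum over $t$ of the maximum row sum or column sum of $D(t)$. The induced flow is $f(R,D)=\sum_{a,b,t}D(t,a,b)R_{a,b,t}$. The design guarantees throughput $r$ if $f(R,D)$ is feasible for every demand function $D$ requesting throughput at most $r$. For $r\in(0,\frac12]$, $(h,\varepsilon)$ denotes the unique solution in $\mathbb N\times(0,1]$ of $\frac1{2r}=h+1-\varepsilon$ (equivalently $h=\lfloor\frac1{2r}\rfloor$, $\varepsilon=h+1-\frac1{2r}$), and $L^*(r,N)=h\left(N^{1/(h+1)}+(\varepsilon N)^{1/h}\right)$. *)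

theory Defs
  imports "HOL-Analysis.Analysis" "HOL-Combinatorics.Permutations"
begin

text \<open>Nodes are 1..N. A connection schedule is given as sch :: int => nat => nat,
  where sch t is the permutation pi_t (already extended periodically to all t in Z).\<close>

definition connection_schedule :: "nat \<Rightarrow> nat \<Rightarrow> (int \<Rightarrow> nat \<Rightarrow> nat) \<Rightarrow> bool" where
  "connection_schedule N T sch \<longleftrightarrow>
     T \<ge> 1 \<and> (\<forall>t. sch t permutes {1..N}) \<and> (\<forall>t. sch (t + int T) = sch t)"

text \<open>A path in the virtual topology: start node, start time, and a list of steps;
  a step True follows the physical edge (i,t) -> (pi_t(i), t+1), a step False
  follows the virtual edge (i,t) -> (i,t+1). Its latency is the number of steps.\<close>

type_synonym path = "nat \<times> int \<times> bool list"

fun end_node :: "(int \<Rightarrow> nat \<Rightarrow> nat) \<Rightarrow> nat \<Rightarrow> int \<Rightarrow> bool list \<Rightarrow> nat" where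
  "end_node sch i t [] = i"
| "end_node sch i t (b # bs) = end_node sch (if b then sch t i else i) (t + 1) bs"

definition latency :: "path \<Rightarrow> nat" where
  "latency P = length (snd (snd P))"

definition path_end :: "(int \<Rightarrow> nat \<Rightarrow> nat) \<Rightarrow> path \<Rightarrow> nat" where
  "path_end sch P = end_node sch (fst P) (fst (snd P)) (snd (snd P))"

definition paths_between :: "(int \<Rightarrow> nat \<Rightarrow> nat) \<Rightarrow> nat \<Rightarrow> nat \<Rightarrow> int \<Rightarrow> path set" where
  "paths_between sch a b t = {P. fst P = a \<and> fst (snd P) = t \<and> path_end sch P = b}"

definition uses_edge :: "(int \<Rightarrow> nat \<Rightarrow> nat) \<Rightarrow> path \<Rightarrow> nat \<times> int \<Rightarrow> bool" where
  "uses_edge sch P e \<longleftrightarrow>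
     (\<exists>k < length (snd (snd P)). snd (snd P) ! k \<and>
        end_node sch (fst P) (fst (snd P)) (take k (snd (snd P))) = fst e \<and>
        fst (snd P) + int k = snd e)"

definition shift_path :: "int \<Rightarrow> path \<Rightarrow> path" where
  "shift_path d P = (fst P, fst (snd P) + d, snd (snd P))"

definition oblivious_routing ::
  "nat \<Rightarrow> nat \<Rightarrow> (int \<Rightarrow> nat \<Rightarrow> nat) \<Rightarrow> (nat \<Rightarrow> nat \<Rightarrow> int \<Rightarrow> path \<Rightarrow> real) \<Rightarrow> bool" where
  "oblivious_routing N T sch R \<longleftrightarrow>
     (\<forall>a\<in>{1..N}. \<forall>b\<in>{1..N}. \<forall>t.
        (\<forall>P. R a b t P \<ge> 0) \<and>
        (\<forall>P. R a b t P \<noteq> 0 \<longrightarrow> P \<in> paths_between sch a b t) \<and>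
        (R a b t has_sum 1) (paths_between sch a b t) \<and>
        (\<forall>P. R a b (t + int T) (shift_path (int T) P) = R a b t P))"

definition ORN_design ::
  "nat \<Rightarrow> nat \<Rightarrow> (int \<Rightarrow> nat \<Rightarrow> nat) \<Rightarrow> (nat \<Rightarrow> nat \<Rightarrow> int \<Rightarrow> path \<Rightarrow> real) \<Rightarrow> bool" where
  "ORN_design N T sch R \<longleftrightarrow> connection_schedule N T sch \<and> oblivious_routing N T sch R"

definition max_latency :: "nat \<Rightarrow> (nat \<Rightarrow> nat \<Rightarrow> int \<Rightarrow> path \<Rightarrow> real) \<Rightarrow> ereal" where
  "max_latency N R = Sup {ereal (real (latency P)) | a b t P.
      a \<in> {1..N} \<and> b \<in> {1..N} \<and> R a b t P > 0}"

definition demand_at_most :: "nat \<Rightarrow> (int \<Rightarrow> nat \<Rightarrow> nat \<Rightarrow> real) \<Rightarrow> real \<Rightarrow> bool" where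
  "demand_at_most N D r \<longleftrightarrow>
     (\<forall>t a b. D t a b \<ge> 0) \<and>
     (\<forall>t. \<forall>a\<in>{1..N}. (\<Sum>b\<in>{1..N}. D t a b) \<le> r) \<and>
     (\<forall>t. \<forall>b\<in>{1..N}. (\<Sum>a\<in>{1..N}. D t a b) \<le> r)"

text \<open>Induced flow f(R,D) (values in ennreal, since it is an infinite sum) and edge loads.\<close>
definition induced_flow ::
  "nat \<Rightarrow> (nat \<Rightarrow> nat \<Rightarrow> int \<Rightarrow> path \<Rightarrow> real) \<Rightarrow> (int \<Rightarrow> nat \<Rightarrow> nat \<Rightarrow> real) \<Rightarrow> path \<Rightarrow> ennreal" where
  "induced_flow N R D P =
     (\<Sum>\<^sub>\<infinity>(a, b, t) \<in> {1..N} \<times> {1..N} \<times> UNIV. ennreal (D t a b * R a b t P))"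

definition load :: "(int \<Rightarrow> nat \<Rightarrow> nat) \<Rightarrow> (path \<Rightarrow> ennreal) \<Rightarrow> nat \<times> int \<Rightarrow> ennreal" where
  "load sch f e = (\<Sum>\<^sub>\<infinity>P \<in> {P. uses_edge sch P e}. f P)"

definition feasible :: "nat \<Rightarrow> (int \<Rightarrow> nat \<Rightarrow> nat) \<Rightarrow> (path \<Rightarrow> ennreal) \<Rightarrow> bool" where
  "feasible N sch f \<longleftrightarrow> (\<forall>i\<in>{1..N}. \<forall>s. load sch f (i, s) \<le> 1)"

definition guarantees_throughput ::
  "nat \<Rightarrow> (int \<Rightarrow> nat \<Rightarrow> nat) \<Rightarrow> (nat \<Rightarrow> nat \<Rightarrow> int \<Rightarrow> path \<Rightarrow> real) \<Rightarrow> real \<Rightarrow> bool" where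
  "guarantees_throughput N sch R r \<longleftrightarrow>
     (\<forall>D. demand_at_most N D r \<longrightarrow> feasible N sch (induced_flow N R D))"

definition h_of :: "real \<Rightarrow> nat" where
  "h_of r = nat \<lfloor>1 / (2 * r)\<rfloor>"

definition eps_of :: "real \<Rightarrow> real" where
  "eps_of r = real (h_of r) + 1 - 1 / (2 * r)"

definition Lstar :: "real \<Rightarrow> nat \<Rightarrow> real" where
  "Lstar r N = real (h_of r) *
     (real N powr (1 / real (h_of r + 1)) + (eps_of r * real N) powr (1 / real (h_of r)))"

end

theory Submission
  imports Defs
begin

text \<open>
  Within \<open>L\<close> steps at most \<open>(L + 1) ^ h\<close> nodes can be reached using at most \<open>h\<close> physical hops;
  suppose this is at most \<open>\<delta> N\<close>. Then for all but a \<open>\<delta>\<close>-fraction of the pairs \<open>(a, b)\<close> every path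
  makes at least \<open>h + 1\<close> physical hops. For a physical edge \<open>e\<close>, let every source within \<open>h\<close> hops
  before \<open>e\<close> send to all nodes uniformly, and let all nodes send uniformly to every destination
  within \<open>h\<close> hops after \<open>e\<close>. As there are at most \<open>\<delta> N\<close> such sources and destinations, this
  demand, scaled by \<open>1 / (1 + \<delta>)\<close>, requests throughput at most \<open>r\<close>, so it loads \<open>e\<close> by at most 1.
  Sum these loads over all edges: a path with at least \<open>h + 1\<close> hops is counted for its first
  \<open>h + 1\<close> hops through its source and for its last \<open>h + 1\<close> hops through its destination, which
  yields \<open>2 (h + 1) r (1 - \<delta>) \<le> 1 + \<delta>\<close>. Since \<open>2 (h + 1) r > 1\<close>, this fails for small \<open>\<delta>\<close>,
  hence \<open>(L + 1) ^ h > \<delta> N\<close>. As \<open>\<epsilon> \<le> 1\<close>, the bound on \<open>L\<close> is of the required order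
  \<open>N powr (1 / h)\<close>, with a constant depending on \<open>r\<close> only.
\<close>

section \<open>Balls of few physical hops and their size\<close>

definition short_words :: "nat \<Rightarrow> nat \<Rightarrow> bool list set" where
  "short_words h n = {bs. length bs = n \<and> length (filter id bs) \<le> h}"

text \<open>Words have length exactly \<open>n\<close>, so every end node lies at time
  \<open>t + n\<close>; shorter paths are covered by waiting.\<close>

definition reach :: "(int \<Rightarrow> nat \<Rightarrow> nat) \<Rightarrow> nat \<Rightarrow> nat \<Rightarrow> int \<Rightarrow> nat \<Rightarrow> nat set" where
  "reach sch h a t n = end_node sch a t ` short_words h n"

lemma finite_short_words: "finite (short_words h n)"
proof -
  have "finite {bs::bool list. set bs \<subseteq> UNIV \<and> length bs = n}"
    by (rule finite_lists_length_eq) simp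
  then show ?thesis
    by (rule finite_subset[rotated]) (auto simp: short_words_def)
qed

text \<open>Induction on the length, splitting by the first letter: a leading \<open>True\<close>
  consumes one of the \<open>h\<close> hops. With \<open>h = m + 1\<close> the two bounds add up to
  \<open>(n + 1) ^ m * (n + 2)\<close>.\<close>

lemma card_short_words: "card (short_words h n) \<le> (n + 1) ^ h"
proof (induction n arbitrary: h)
  case 0
  have "short_words h 0 = {[]}" by (auto simp: short_words_def)
  then show ?case by simp
next
  case (Suc n)
  show ?case
  proof (cases h)
    case 0
    have "short_words 0 (Suc n) \<subseteq> (#) False ` short_words 0 n"
    proof
      fix bs assume "bs \<in> short_words 0 (Suc n)"
      then show "bs \<in> (#) False ` short_words 0 n"
        by (cases bs) (auto simp: short_words_def split: if_splits)
    qed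
    then have "card (short_words 0 (Suc n)) \<le> card (short_words 0 n)"
      by (rule surj_card_le[OF finite_short_words])
    with Suc.IH[of 0] 0 show ?thesis by simp
  next
    case (Suc m)
    have "short_words h (Suc n) \<subseteq> (#) False ` short_words h n \<union> (#) True ` short_words m n"
    proof
      fix bs assume "bs \<in> short_words h (Suc n)"
      then show "bs \<in> (#) False ` short_words h n \<union> (#) True ` short_words m n"
        using Suc by (cases bs) (auto simp: short_words_def split: if_splits)
    qed
    then have "card (short_words h (Suc n))
        \<le> card ((#) False ` short_words h n \<union> (#) True ` short_words m n)"
      by (intro card_mono) (auto simp: finite_short_words)
    also have "\<dots> \<le> card (short_words h n) + card (short_words m n)"
      by (intro order.trans[OF card_Un_le] add_mono card_image_le finite_short_words)
    also have "\<dots> \<le> (n + 1) ^ h + (n + 1) ^ m"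
      by (intro add_mono Suc.IH)
    also have "\<dots> = (n + 1) ^ m * (Suc n + 1)"
      using Suc by simp
    also have "\<dots> \<le> (Suc n + 1) ^ m * (Suc n + 1)"
      by (intro mult_right_mono power_mono) auto
    finally show ?thesis using Suc by (simp add: mult.commute)
  qed
qed

lemma card_reach: "card (reach sch h a t n) \<le> (n + 1) ^ h"
  unfolding reach_def
  by (rule order.trans[OF card_image_le[OF finite_short_words] card_short_words])

lemma end_node_append:
  "end_node sch a t (xs @ ys) = end_node sch (end_node sch a t xs) (t + int (length xs)) ys"
  by (induction xs arbitrary: a t) (auto simp: add.assoc)

lemma end_node_replicate_False [simp]: "end_node sch a t (replicate n False) = a"
  by (induction n arbitrary: t) auto

lemma end_node_mem:
  assumes "\<And>t. sch t permutes {1..N}" "a \<in> {1..N}"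
  shows "end_node sch a t bs \<in> {1..N}"
  using assms(2)
proof (induction bs arbitrary: a t)
  case (Cons b bs)
  have "sch t a \<in> {1..N}"
    using Cons.prems permutes_in_image[OF assms(1)] by blast
  then show ?case using Cons by auto
qed auto

text \<open>From a fixed start time, a fixed word acts on nodes as a composition of permutations and
  identities.\<close>

lemma end_node_inj:
  assumes "\<And>t. sch t permutes S" "end_node sch a t bs = end_node sch a' t bs"
  shows "a = a'"
  using assms(2)
proof (induction bs arbitrary: a a' t)
  case (Cons b bs)
  show ?case
  proof (cases b)
    case True
    then have "sch t a = sch t a'" using Cons by auto
    then show ?thesis using permutes_inj[OF assms(1)] by (auto dest: injD)
  qed (use Cons in auto)
qed auto

text \<open>By injectivity a word and its end node determine the source, so sources of
  \<open>i\<close> are counted by words, just as targets are.\<close>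

lemma card_sources_le:
  assumes "\<And>t. sch t permutes S"
  shows "finite {a. i \<in> reach sch h a t n}"
    and "card {a. i \<in> reach sch h a t n} \<le> (n + 1) ^ h"
proof -
  let ?F = "\<lambda>bs. THE a. end_node sch a t bs = i"
  have sub: "{a. i \<in> reach sch h a t n} \<subseteq> ?F ` short_words h n"
  proof clarify
    fix a assume "i \<in> reach sch h a t n"
    then obtain bs where bs: "bs \<in> short_words h n" "end_node sch a t bs = i"
      by (auto simp: reach_def)
    have "?F bs = a"
    proof (rule the_equality)
      show "end_node sch a t bs = i" by (rule bs(2))
      show "a' = a" if "end_node sch a' t bs = i" for a'
        using end_node_inj[of sch S, OF assms] that bs(2) by metis
    qed
    with bs(1) show "a \<in> ?F ` short_words h n" by blast
  qed
  show "finite {a. i \<in> reach sch h a t n}"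
    by (rule finite_subset[OF sub]) (simp add: finite_short_words)
  show "card {a. i \<in> reach sch h a t n} \<le> (n + 1) ^ h"
    using surj_card_le[OF finite_short_words sub] card_short_words order.trans by blast
qed

text \<open>Padding with virtual steps changes neither the end node nor the number of hops.\<close>

lemma end_node_in_reach:
  assumes "length bs \<le> n" "length (filter id bs) \<le> h"
  shows "end_node sch a t bs \<in> reach sch h a t n"
proof -
  have "bs @ replicate (n - length bs) False \<in> short_words h n"
    using assms by (auto simp: short_words_def filter_replicate)
  moreover have "end_node sch a t (bs @ replicate (n - length bs) False) = end_node sch a t bs"
    by (simp add: end_node_append)
  ultimately show ?thesis
    unfolding reach_def by (metis imageI)
qed

section \<open>Counting the first and the last hops of a word\<close>

lemma card_first_hops:
  "card {k. k < length bs \<and> bs ! k \<and> length (filter id (take k bs)) \<le> h}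
     = min (h + 1) (length (filter id bs))"
proof (induction bs rule: rev_induct)
  case (snoc x bs)
  define K where "K bs = {k. k < length bs \<and> bs ! k \<and> length (filter id (take k bs)) \<le> h}" for bs
  have "K (bs @ [x]) = K bs \<union> (if x \<and> length (filter id bs) \<le> h then {length bs} else {})"
    by (auto simp: K_def nth_append less_Suc_eq)
  moreover have "finite (K bs)" "length bs \<notin> K bs" by (auto simp: K_def)
  ultimately show ?case using snoc.IH unfolding K_def[symmetric] by (auto simp: id_def)
qed simp

text \<open>Mirror image of \<open>card_first_hops\<close>: prepending a letter keeps the suffixes
  and shifts positions by \<open>Suc\<close>, so the induction runs from the front.\<close>

lemma card_last_hops:
  "card {k. k < length bs \<and> bs ! k \<and> length (filter id (drop (Suc k) bs)) \<le> h}
     = min (h + 1) (length (filter id bs))"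
proof (induction bs)
  case (Cons x bs)
  define K where "K bs = {k. k < length bs \<and> bs ! k \<and> length (filter id (drop (Suc k) bs)) \<le> h}" for bs
  have "K (x # bs) = Suc ` K bs \<union> (if x \<and> length (filter id bs) \<le> h then {0} else {})"
  proof (rule set_eqI)
    fix k
    show "k \<in> K (x # bs) \<longleftrightarrow>
        k \<in> Suc ` K bs \<union> (if x \<and> length (filter id bs) \<le> h then {0} else {})"
      by (cases k) (auto simp: K_def)
  qed
  moreover have "finite (K bs)" by (auto simp: K_def)
  ultimately show ?case using Cons.IH unfolding K_def[symmetric] by (auto simp: card_image id_def)
qed simp

section \<open>Edge loads as finite sums, and the contribution of a single path\<close>

lemma sum_le_infsum_ennreal:
  fixes f :: "'a \<Rightarrow> ennreal"
  assumes "finite F" "F \<subseteq> A"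
  shows "sum f F \<le> infsum f A"
  using assms by (subst nonneg_infsum_complete) (auto intro!: SUP_upper)

text \<open>All terms are nonnegative, so truncating the infinite load to start times in
  \<open>I\<close> and words in \<open>W\<close> can only lower it. This gives a finite real sum fit
  for double counting.\<close>

lemma edge_load_le:
  fixes R :: "nat \<Rightarrow> nat \<Rightarrow> int \<Rightarrow> path \<Rightarrow> real"
  assumes feas: "feasible N sch (induced_flow N R D)" and i: "i \<in> {1..N}"
    and D: "\<And>t a b. D t a b \<ge> 0"
    and R: "\<And>a b t P. a \<in> {1..N} \<Longrightarrow> b \<in> {1..N} \<Longrightarrow> R a b t P \<ge> 0"
    and fin: "finite I" "finite W"
  shows "(\<Sum>(a, t, bs)\<in>{1..N} \<times> I \<times> W. \<Sum>b\<in>{1..N}.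
            of_bool (uses_edge sch (a, t, bs) (i, s)) * (D t a b * R a b t (a, t, bs))) \<le> 1"
proof -
  let ?X = "{P \<in> {1..N} \<times> I \<times> W. uses_edge sch P (i, s)}"
  let ?g = "\<lambda>P. \<Sum>b\<in>{1..N}. D (fst (snd P)) (fst P) b * R (fst P) b (fst (snd P)) P"
  have g: "ennreal (?g P) \<le> induced_flow N R D P" if "P \<in> ?X" for P
  proof -
    obtain a t bs where P: "P = (a, t, bs)" by (cases P) auto
    with that have a: "a \<in> {1..N}" by auto
    \<comment> \<open>Of all demand triples only those with the start node and start time of
      \<open>P\<close> are kept.\<close>
    let ?f = "\<lambda>(a, b, t). ennreal (D t a b * R a b t P)"
    have "ennreal (?g P) = (\<Sum>b\<in>{1..N}. ?f (a, b, t))"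
      using a by (simp add: P) (intro sum_ennreal[symmetric] mult_nonneg_nonneg D R, auto)
    also have "\<dots> = (\<Sum>x\<in>(\<lambda>b. (a, b, t)) ` {1..N}. ?f x)"
      by (subst sum.reindex) (auto intro!: inj_onI)
    also have "\<dots> \<le> induced_flow N R D P"
      unfolding induced_flow_def using a
      by (intro sum_le_infsum_ennreal) auto
    finally show ?thesis .
  qed
  have "(\<Sum>(a, t, bs)\<in>{1..N} \<times> I \<times> W. \<Sum>b\<in>{1..N}.
            of_bool (uses_edge sch (a, t, bs) (i, s)) * (D t a b * R a b t (a, t, bs)))
      = (\<Sum>P\<in>{1..N} \<times> I \<times> W. if uses_edge sch P (i, s) then ?g P else 0)"
    by (intro sum.cong) auto
  also have "\<dots> = sum ?g ?X"
    using fin by (subst sum.inter_filter) auto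
  finally have eq: "(\<Sum>(a, t, bs)\<in>{1..N} \<times> I \<times> W. \<Sum>b\<in>{1..N}.
            of_bool (uses_edge sch (a, t, bs) (i, s)) * (D t a b * R a b t (a, t, bs))) = sum ?g ?X" .
  have "ennreal (sum ?g ?X) = (\<Sum>P\<in>?X. ennreal (?g P))"
    using D R by (subst sum_ennreal) (auto intro!: sum_nonneg)
  also have "\<dots> \<le> (\<Sum>P\<in>?X. induced_flow N R D P)"
    by (intro sum_mono g)
  also have "\<dots> \<le> load sch (induced_flow N R D) (i, s)"
    unfolding load_def using fin
    by (intro sum_le_infsum_ennreal) auto
  also have "\<dots> \<le> 1"
    using feas i by (auto simp: feasible_def)
  finally show ?thesis
    unfolding eq by (simp add: ennreal_le_1)
qed

text \<open>Each of the first \<open>h + 1\<close> hops leaves a node within \<open>h\<close> hops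
  of the source, and after each of the last \<open>h + 1\<close> hops at most \<open>h\<close>
  remain. The two families may overlap; an edge in both is counted twice because the indicators are
  added.\<close>

lemma sum_over_path_ge:
  assumes perm: "\<And>t. sch t permutes {1..N}" and a: "a \<in> {1..N}"
    and t: "t \<in> {0..<int M}" and len: "length bs \<le> L" and hops: "h + 1 \<le> length (filter id bs)"
  shows "2 * (real h + 1) \<le> (\<Sum>(i, s)\<in>{1..N} \<times> {0..<int (M + L)}.
     of_bool (uses_edge sch (a, t, bs) (i, s)) *
       (of_bool (t \<le> s \<and> s \<le> t + int L \<and> i \<in> reach sch h a t (nat (s - t)))
        + of_bool (end_node sch a t bs \<in> reach sch h (sch s i) (s + 1) L)))"
    (is "_ \<le> (\<Sum>(i, s)\<in>?E. of_bool (?u i s) * (of_bool (?p i s) + of_bool (?q i s)))")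
proof -
  \<comment> \<open>The tail of the edge at position \<open>k\<close>. Its time coordinate makes
    \<open>?e\<close> injective, so counting positions counts edges.\<close>
  let ?e = "\<lambda>k. (end_node sch a t (take k bs), t + int k)"
  have inj: "inj_on ?e K" for K by (auto intro!: inj_onI)
  let ?K1 = "{k. k < length bs \<and> bs ! k \<and> length (filter id (take k bs)) \<le> h}"
  let ?K2 = "{k. k < length bs \<and> bs ! k \<and> length (filter id (drop (Suc k) bs)) \<le> h}"
  have E: "?e k \<in> ?E" and u: "bs ! k \<Longrightarrow> ?u (fst (?e k)) (snd (?e k))" if "k < length bs" for k
    using that t len end_node_mem[of sch, OF perm a] by (auto simp: uses_edge_def)
  have p: "?p (fst (?e k)) (snd (?e k))" if "k \<in> ?K1" for k
    using that len end_node_in_reach[of "take k bs" k h sch a t] by auto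
  have q: "?q (fst (?e k)) (snd (?e k))" if "k \<in> ?K2" for k
  proof -
    from that have k: "k < length bs" "bs ! k = True" by auto
    \<comment> \<open>Split the word at its hop \<open>k\<close>: the rest starts at the head of
      that edge, one time step later.\<close>
    have "end_node sch a t bs = end_node sch a t (take k bs @ True # drop (Suc k) bs)"
      using id_take_nth_drop[OF k(1)] unfolding k(2) by (rule arg_cong)
    also have "\<dots> = end_node sch (sch (t + int k) (end_node sch a t (take k bs))) (t + int k + 1)
        (drop (Suc k) bs)"
      using that by (simp add: end_node_append min_def)
    also have "\<dots> \<in> reach sch h (sch (t + int k) (end_node sch a t (take k bs))) (t + int k + 1) L"
      using that len by (intro end_node_in_reach) auto
    finally show ?thesis by simp
  qed
  have fin: "finite ?E" by simp
  have "h + 1 = card (?e ` ?K1)"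
    using card_first_hops[of bs h] hops by (simp add: card_image[OF inj])
  also have "\<dots> \<le> card {x \<in> ?E. ?u (fst x) (snd x) \<and> ?p (fst x) (snd x)}"
    by (rule card_mono) (use fin E u p in auto)
  finally have 1: "h + 1 \<le> card {x \<in> ?E. ?u (fst x) (snd x) \<and> ?p (fst x) (snd x)}" .
  have "h + 1 = card (?e ` ?K2)"
    using card_last_hops[of bs h] hops by (simp add: card_image[OF inj])
  also have "\<dots> \<le> card {x \<in> ?E. ?u (fst x) (snd x) \<and> ?q (fst x) (snd x)}"
    by (rule card_mono) (use fin E u q in auto)
  finally have 2: "h + 1 \<le> card {x \<in> ?E. ?u (fst x) (snd x) \<and> ?q (fst x) (snd x)}" .
  have "(\<Sum>(i, s)\<in>?E. of_bool (?u i s) * (of_bool (?p i s) + of_bool (?q i s)))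
     = (\<Sum>x\<in>?E. of_bool (?u (fst x) (snd x) \<and> ?p (fst x) (snd x)))
       + (\<Sum>x\<in>?E. of_bool (?u (fst x) (snd x) \<and> ?q (fst x) (snd x)) :: real)"
    unfolding sum.distrib[symmetric] by (intro sum.cong) auto
  also have "\<dots> = real (card {x \<in> ?E. ?u (fst x) (snd x) \<and> ?p (fst x) (snd x)})
      + real (card {x \<in> ?E. ?u (fst x) (snd x) \<and> ?q (fst x) (snd x)})"
    by (simp add: sum_of_bool_eq[OF fin] Int_def)
  finally have eq: "(\<Sum>(i, s)\<in>?E. of_bool (?u i s) * (of_bool (?p i s) + of_bool (?q i s)))
     = real (card {x \<in> ?E. ?u (fst x) (snd x) \<and> ?p (fst x) (snd x)})
      + real (card {x \<in> ?E. ?u (fst x) (snd x) \<and> ?q (fst x) (snd x)})" .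
  have "2 * (real h + 1) = real (h + 1) + real (h + 1)" by simp
  also have "\<dots> \<le> real (card {x \<in> ?E. ?u (fst x) (snd x) \<and> ?p (fst x) (snd x)})
      + real (card {x \<in> ?E. ?u (fst x) (snd x) \<and> ?q (fst x) (snd x)})"
    by (intro add_mono of_nat_mono 1 2)
  finally show ?thesis unfolding eq .
qed

lemma sum_triple:
  "(\<Sum>a\<in>A. \<Sum>b\<in>B. \<Sum>c\<in>C. f a b c) = (\<Sum>(a, b, c)\<in>A \<times> B \<times> C. f a b c)"
  by (simp add: sum.cartesian_product)

section \<open>Averaging the edge loads over a long time window\<close>

lemma throughput_bound_of_small_balls:
  fixes R :: "nat \<Rightarrow> nat \<Rightarrow> int \<Rightarrow> path \<Rightarrow> real"
  assumes design: "ORN_design N T sch R" and thr: "guarantees_throughput N sch R r"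
    and N: "N \<ge> 1" and r: "r > 0" and \<delta>: "\<delta> \<ge> 0"
    and lat: "\<And>a b t P. a \<in> {1..N} \<Longrightarrow> b \<in> {1..N} \<Longrightarrow> R a b t P > 0 \<Longrightarrow> latency P \<le> L"
    and small: "(real L + 1) ^ h \<le> \<delta> * real N"
  shows "2 * (real h + 1) * r * (1 - \<delta>) \<le> 1 + \<delta>"
proof -
  let ?A = "{1..N}"
  define W where "W = {bs :: bool list. length bs \<le> L}"
  \<comment> \<open>\<open>t \<le> s\<close> is needed since \<open>nat\<close> would turn a
    negative \<open>s - t\<close> into 0; \<open>s \<le> t + int L\<close> keeps the ball within
    \<open>L\<close> steps.\<close>
  define src where "src i s t a = (of_bool (t \<le> s \<and> s \<le> t + int L \<and>
      i \<in> reach sch h a t (nat (s - t))) :: real)" for i s t a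
  \<comment> \<open>The ball starts at the head of the edge, hence \<open>sch s i\<close> and
    \<open>s + 1\<close>. No condition on the start time \<open>t\<close> is imposed.\<close>
  define dst where "dst i s b = (of_bool (b \<in> reach sch h (sch s i) (s + 1) L) :: real)" for i s b
  define far where "far a t b = (of_bool (b \<notin> reach sch h a t L) :: real)" for a t b
  \<comment> \<open>A row or column gets at most \<open>N\<close> from one indicator and
    \<open>\<delta> * N\<close> from the other; \<open>\<rho>\<close> scales this total to
    \<open>r\<close>.\<close>
  define \<rho> where "\<rho> = r / (real N * (1 + \<delta>))"
  define D where "D i s t a b = \<rho> * (src i s t a + dst i s b)" for i s t a b
  define K where "K = 2 * (real h + 1)"
  have perm: "\<And>t. sch t permutes {1..N}"
    using design by (auto simp: ORN_design_def connection_schedule_def)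
  have routing: "oblivious_routing N T sch R"
    using design by (simp add: ORN_design_def)
  have Rnn: "R a b t P \<ge> 0" if "a \<in> ?A" "b \<in> ?A" for a b t P
    using routing that unfolding oblivious_routing_def by blast
  have Rsupp: "P \<in> paths_between sch a b t" if "a \<in> ?A" "b \<in> ?A" "R a b t P \<noteq> 0" for a b t P
    using routing that unfolding oblivious_routing_def by blast
  have Rsum: "(R a b t has_sum 1) (paths_between sch a b t)" if "a \<in> ?A" "b \<in> ?A" for a b t
    using routing that unfolding oblivious_routing_def by blast
  have finW: "finite W"
    using finite_lists_length_le[of "UNIV :: bool set" L] by (simp add: W_def)
  have \<rho>: "\<rho> > 0" using r N \<delta> by (simp add: \<rho>_def)
  have small_ball: "real ((n + 1) ^ h) \<le> \<delta> * real N" if "n \<le> L" for n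
  proof -
    have "real ((n + 1) ^ h) \<le> (real L + 1) ^ h"
      using that by (simp add: power_mono)
    with small show ?thesis by simp
  qed

  have sum_dst: "(\<Sum>b\<in>?A. dst i s b) \<le> \<delta> * real N" for i s
  proof -
    have "(\<Sum>b\<in>?A. dst i s b) = real (card {b \<in> ?A. b \<in> reach sch h (sch s i) (s + 1) L})"
      by (simp add: dst_def sum_of_bool_eq Int_def)
    also have "card {b \<in> ?A. b \<in> reach sch h (sch s i) (s + 1) L} \<le> card (reach sch h (sch s i) (s + 1) L)"
      by (intro card_mono) (auto simp: reach_def finite_short_words)
    also have "\<dots> \<le> (L + 1) ^ h" by (rule card_reach)
    finally show ?thesis using small_ball[of L] by simp
  qed
  have sum_src: "(\<Sum>a\<in>?A. src i s t a) \<le> \<delta> * real N" for i s t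
  proof (cases "t \<le> s \<and> s \<le> t + int L")
    case True
    have "(\<Sum>a\<in>?A. src i s t a) = real (card {a \<in> ?A. i \<in> reach sch h a t (nat (s - t))})"
      using True by (simp add: src_def sum_of_bool_eq Int_def)
    also have "card {a \<in> ?A. i \<in> reach sch h a t (nat (s - t))}
        \<le> card {a. i \<in> reach sch h a t (nat (s - t))}"
      by (intro card_mono card_sources_le[OF perm]) auto
    also have "\<dots> \<le> (nat (s - t) + 1) ^ h" by (rule card_sources_le[OF perm])
    also have "real \<dots> \<le> \<delta> * real N" using True by (intro small_ball) auto
    finally show ?thesis by simp
  next
    case False
    then have "src i s t a = 0" for a by (auto simp: src_def)
    then show ?thesis using \<delta> by simp
  qed
  have \<rho>r: "\<rho> * (real N + \<delta> * real N) = r"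
  proof -
    have "real N + \<delta> * real N = real N * (1 + \<delta>)" by (simp add: algebra_simps)
    moreover have "real N \<noteq> 0" "1 + \<delta> \<noteq> 0" using N \<delta> by auto
    ultimately show ?thesis by (simp add: \<rho>_def)
  qed
  have demand: "demand_at_most N (D i s) r" for i s
    unfolding demand_at_most_def
  proof (intro conjI allI ballI)
    show "0 \<le> D i s t a b" for t a b
      using \<rho> by (simp add: D_def src_def dst_def)
    show "(\<Sum>b\<in>?A. D i s t a b) \<le> r" for t a
    proof -
      have "(\<Sum>b\<in>?A. D i s t a b) = \<rho> * (real N * src i s t a + (\<Sum>b\<in>?A. dst i s b))"
        by (simp add: D_def sum.distrib flip: sum_distrib_left)
      also have "\<dots> \<le> \<rho> * (real N + \<delta> * real N)"
        using \<rho> sum_dst[of i s] by (intro mult_left_mono add_mono) (auto simp: src_def)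
      finally show ?thesis by (simp only: \<rho>r)
    qed
    show "(\<Sum>a\<in>?A. D i s t a b) \<le> r" for t b
    proof -
      have "(\<Sum>a\<in>?A. D i s t a b) = \<rho> * (real N * dst i s b + (\<Sum>a\<in>?A. src i s t a))"
        by (simp add: D_def sum.distrib add.commute flip: sum_distrib_left)
      also have "\<dots> \<le> \<rho> * (real N + \<delta> * real N)"
        using \<rho> sum_src[of i s t] by (intro mult_left_mono add_mono) (auto simp: dst_def)
      finally show ?thesis by (simp only: \<rho>r)
    qed
  qed

  have Rsum1: "(\<Sum>bs\<in>W. R a b t (a, t, bs)) = 1" if ab: "a \<in> ?A" "b \<in> ?A" for a b t
  proof -
    let ?F = "(\<lambda>bs. (a, t, bs)) ` W"
    have supp: "P \<in> ?F" if "R a b t P \<noteq> 0" for P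
    proof -
      have "R a b t P > 0" using Rnn[OF ab] that by (simp add: order_less_le)
      then have "latency P \<le> L" using lat ab by blast
      moreover have "P \<in> paths_between sch a b t" using Rsupp ab that by blast
      ultimately show ?thesis
        by (cases P) (auto simp: paths_between_def latency_def W_def)
    qed
    \<comment> \<open>The latency bound confines the support to the finite set \<open>?F\<close>, so
      the unit of flow is a finite sum.\<close>
    have "(R a b t has_sum 1) (paths_between sch a b t) \<longleftrightarrow> (R a b t has_sum 1) ?F"
      by (rule has_sum_cong_neutral) (use supp Rsupp[OF ab] in blast)+
    then have "(R a b t has_sum 1) ?F" using Rsum ab by blast
    moreover have "(R a b t has_sum sum (R a b t) ?F) ?F"
      by (rule has_sum_finite) (simp add: finW)
    ultimately have "sum (R a b t) ?F = 1" using has_sum_unique by blast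
    then show ?thesis by (subst (asm) sum.reindex) (auto intro!: inj_onI)
  qed

  \<comment> \<open>Sources are restricted to a time window of length \<open>M\<close>; the boundary term \<open>L\<close> disappears
    as \<open>M\<close> grows.\<close>
  have key: "real M * (\<rho> * K * (real N * (1 - \<delta>))) \<le> real M + real L" for M :: nat
  proof -
    let ?I = "{0..<int M}" and ?E = "?A \<times> {0..<int (M + L)}"
    let ?u = "\<lambda>a t bs i s. of_bool (uses_edge sch (a, t, bs) (i, s)) :: real"
    have path: "far a t b * K * R a b t (a, t, bs)
        \<le> (\<Sum>(i, s)\<in>?E. ?u a t bs i s * (src i s t a + dst i s b)) * R a b t (a, t, bs)"
      if "a \<in> ?A" "b \<in> ?A" "t \<in> ?I" "bs \<in> W" for a b t bs
    proof (cases "far a t b = 0 \<or> R a b t (a, t, bs) = 0")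
      case True
      have "0 \<le> (\<Sum>(i, s)\<in>?E. ?u a t bs i s * (src i s t a + dst i s b))"
        by (intro sum_nonneg) (auto simp: src_def dst_def)
      then show ?thesis using True Rnn that by auto
    next
      case False
      then have b: "b = end_node sch a t bs"
        using Rsupp[of a b t "(a, t, bs)"] that by (auto simp: paths_between_def path_end_def)
      have len: "length bs \<le> L" using that by (simp add: W_def)
      have "b \<notin> reach sch h a t L" using False by (simp add: far_def)
      \<comment> \<open>Otherwise padding the path would put \<open>b\<close> into the ball of
        \<open>h\<close> hops around \<open>a\<close>.\<close>
      then have hops: "h + 1 \<le> length (filter id bs)"
        using len end_node_in_reach[of bs L h sch a t] unfolding b by linarith
      have "K \<le> (\<Sum>(i, s)\<in>?E. ?u a t bs i s * (src i s t a + dst i s b))"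
        using sum_over_path_ge[of sch N a t M bs L h, OF perm that(1,3) len hops]
        by (simp add: K_def src_def dst_def b)
      then show ?thesis
        using False Rnn[OF that(1,2)] by (intro mult_right_mono) (auto simp: far_def)
    qed
    have far_sum: "real N * (1 - \<delta>) \<le> (\<Sum>b\<in>?A. far a t b)" for a t
    proof -
      have "(\<Sum>b\<in>?A. far a t b) = real (card (?A - reach sch h a t L))"
        by (simp add: far_def sum_of_bool_eq Int_def set_diff_eq)
      moreover have "N \<le> card (?A - reach sch h a t L) + (L + 1) ^ h"
        using diff_card_le_card_Diff[of "reach sch h a t L" ?A] card_reach[of sch h a t L]
        by (simp add: reach_def finite_short_words)
      then have "real N \<le> real (card (?A - reach sch h a t L)) + real ((L + 1) ^ h)"
        unfolding of_nat_add[symmetric] by (rule of_nat_mono)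
      ultimately show ?thesis using small_ball[of L] by (simp add: algebra_simps)
    qed
    \<comment> \<open>Double counting: insert the unit flow of each far pair, charge its paths
      \<open>K\<close> on the edges, and exchange the sums. Each of the \<open>N * (M + L)\<close>
      edges \<open>(i, s)\<close> is then loaded by its own demand \<open>D i s\<close>, by at most
      1.\<close>
    have "real M * (\<rho> * K * (real N * (1 - \<delta>))) * real N
        = (\<Sum>a\<in>?A. \<Sum>t\<in>?I. \<rho> * K * (real N * (1 - \<delta>)))"
      by simp
    also have "\<dots> \<le> (\<Sum>a\<in>?A. \<Sum>t\<in>?I. \<rho> * K * (\<Sum>b\<in>?A. far a t b))"
      using \<rho> far_sum by (intro sum_mono mult_left_mono) (auto simp: K_def)
    also have "\<dots> = (\<Sum>a\<in>?A. \<Sum>t\<in>?I. \<Sum>b\<in>?A. \<rho> * (far a t b * K * (\<Sum>bs\<in>W. R a b t (a, t, bs))))"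
      by (intro sum.cong refl) (simp add: Rsum1 sum_distrib_left sum_distrib_right algebra_simps)
    also have "\<dots> = (\<Sum>a\<in>?A. \<Sum>t\<in>?I. \<Sum>bs\<in>W. \<Sum>b\<in>?A. \<rho> * (far a t b * K * R a b t (a, t, bs)))"
      by (intro sum.cong refl, subst sum.swap) (simp add: sum_distrib_left)
    also have "\<dots> \<le> (\<Sum>a\<in>?A. \<Sum>t\<in>?I. \<Sum>bs\<in>W. \<Sum>b\<in>?A.
        \<rho> * ((\<Sum>(i, s)\<in>?E. ?u a t bs i s * (src i s t a + dst i s b)) * R a b t (a, t, bs)))"
      using \<rho> by (intro sum_mono mult_left_mono path) auto
    also have "\<dots> = (\<Sum>(a, t, bs)\<in>?A \<times> ?I \<times> W. \<Sum>b\<in>?A.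
        \<rho> * ((\<Sum>(i, s)\<in>?E. ?u a t bs i s * (src i s t a + dst i s b)) * R a b t (a, t, bs)))"
      by (rule sum_triple)
    also have "\<dots> = (\<Sum>(a, t, bs)\<in>?A \<times> ?I \<times> W. \<Sum>b\<in>?A. \<Sum>(i, s)\<in>?E.
        ?u a t bs i s * (D i s t a b * R a b t (a, t, bs)))"
      unfolding D_def case_prod_unfold sum_distrib_left sum_distrib_right by (simp only: mult_ac)
    also have "\<dots> = (\<Sum>(i, s)\<in>?E. \<Sum>(a, t, bs)\<in>?A \<times> ?I \<times> W. \<Sum>b\<in>?A.
        ?u a t bs i s * (D i s t a b * R a b t (a, t, bs)))"
      unfolding case_prod_unfold by (subst sum.swap, subst (2) sum.swap) (rule refl)
    also have "\<dots> \<le> (\<Sum>(i, s)\<in>?E. 1)"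
    proof (intro sum_mono, clarify)
      fix i s assume i: "i \<in> ?A"
      have "feasible N sch (induced_flow N R (D i s))"
        using thr demand by (auto simp: guarantees_throughput_def)
      from edge_load_le[OF this i _ Rnn _ finW, of ?I s] demand[of i s]
      show "(\<Sum>(a, t, bs)\<in>?A \<times> ?I \<times> W. \<Sum>b\<in>?A.
          ?u a t bs i s * (D i s t a b * R a b t (a, t, bs))) \<le> 1"
        by (simp add: demand_at_most_def)
    qed
    also have "\<dots> = (real M + real L) * real N" by (simp add: case_prod_unfold)
    finally show ?thesis using N by (simp add: mult_ac)
  qed
  define x where "x = \<rho> * K * (real N * (1 - \<delta>))"
  have "x \<le> 1"
  proof (rule ccontr)
    assume "\<not> x \<le> 1"
    then obtain M :: nat where "real L < real M * (x - 1)"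
      using reals_Archimedean3[of "x - 1"] by auto
    with key[of M] show False by (simp add: x_def algebra_simps)
  qed
  moreover have "x * (1 + \<delta>) = K * r * (1 - \<delta>)"
    using N \<delta> by (simp add: x_def \<rho>_def)
  ultimately show ?thesis
    using \<delta> mult_right_mono[of x 1 "1 + \<delta>"] by (simp add: K_def)
qed

section \<open>Choice of the constants and the latency bound\<close>

theorem theorem3p2:
  fixes r :: real
  assumes "0 < r" and "r \<le> 1 / 2"
  shows "\<exists>c > 0. \<forall>N \<ge> 2. \<forall>(T::nat) sch R.
           ORN_design N T sch R \<and> guarantees_throughput N sch R r \<longrightarrow>
           ereal (c * Lstar r N) \<le> max_latency N R"
proof -
  define h where "h = h_of r"
  have "1 / (2 * r) \<ge> 1" using assms by (simp add: field_simps)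
  then have h1: "h \<ge> 1" and hle: "real h \<le> 1 / (2 * r)" and hgt: "1 / (2 * r) < real h + 1"
    unfolding h_def h_of_def by linarith+
  define K where "K = 2 * (real h + 1) * r"
  have K: "K > 1" using hgt assms by (simp add: K_def field_simps)
  \<comment> \<open>Half of \<open>(K - 1) / (K + 1)\<close>, the value at which
    \<open>K * (1 - \<delta>)\<close> equals \<open>1 + \<delta>\<close>.\<close>
  define \<delta> where "\<delta> = (K - 1) / 2 / (K + 1)"
  have \<delta>0: "\<delta> > 0" using K by (simp add: \<delta>_def)
  have "\<delta> * (K + 1) = (K - 1) / 2"
    unfolding \<delta>_def using K by (intro nonzero_eq_divide_eq[THEN iffD1]) auto
  then have K\<delta>: "K * (1 - \<delta>) > 1 + \<delta>" using K by (simp add: algebra_simps)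
  have eps: "eps_of r \<le> 1" "eps_of r > 0" using hle hgt by (auto simp: eps_of_def h_def)
  \<comment> \<open>The factor \<open>4 * h\<close> absorbs
    \<open>Lstar r N \<le> 2 * h * N powr (1 / h)\<close> and
    \<open>L + 1 \<le> 2 * L\<close>.\<close>
  define c where "c = \<delta> powr (1 / real h) / (4 * real h)"
  have c: "c > 0" using \<delta>0 h1 by (simp add: c_def)
  have "ereal (c * Lstar r N) \<le> max_latency N R"
    if N: "N \<ge> 2" and design: "ORN_design N T sch R" and thr: "guarantees_throughput N sch R r"
    for N T sch R
  proof (rule ccontr)
    assume "\<not> ereal (c * Lstar r N) \<le> max_latency N R"
    then have less: "max_latency N R < ereal (c * Lstar r N)" by simp
    \<comment> \<open>The rounded-down target bound; every latency is at most \<open>L\<close>. The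
      contradiction will be that the target lies below its own floor.\<close>
    define L where "L = nat \<lfloor>c * Lstar r N\<rfloor>"
    have lat': "real (latency P) \<le> c * Lstar r N"
      if "a \<in> {1..N}" "b \<in> {1..N}" "R a b t P > 0" for a b t P
    proof -
      have "ereal (real (latency P)) \<le> max_latency N R"
        unfolding max_latency_def using that by (intro Sup_upper) blast
      then have "ereal (real (latency P)) < ereal (c * Lstar r N)"
        using less by (rule order.strict_trans1)
      then show ?thesis by simp
    qed
    have lat: "latency P \<le> L" if "a \<in> {1..N}" "b \<in> {1..N}" "R a b t P > 0" for a b t P
      using lat'[OF that] by (simp add: L_def le_nat_floor)
    \<comment> \<open>A path carrying flow from node 1 to node 2 has at least one step. This gives
      \<open>L + 1 \<le> 2 * L\<close> and excludes that \<open>nat\<close> truncated a negative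
      floor.\<close>
    have L1: "L \<ge> 1"
    proof -
      have ab: "1 \<in> {1..N}" "2 \<in> {1..N}" using N by auto
      have routing: "oblivious_routing N T sch R" using design by (simp add: ORN_design_def)
      have "(R 1 2 0 has_sum 1) (paths_between sch 1 2 0)"
        using routing ab unfolding oblivious_routing_def by blast
      then have "\<not> (R 1 2 0 has_sum 0) (paths_between sch 1 2 0)"
        using has_sum_unique[of "R 1 2 0" "paths_between sch 1 2 0" 1 0] by auto
      then obtain P where P: "P \<in> paths_between sch 1 2 0" "R 1 2 0 P \<noteq> 0"
        using has_sum_0[of "paths_between sch 1 2 0" "R 1 2 0"] by blast
      have "R 1 2 0 P \<ge> 0" using routing ab unfolding oblivious_routing_def by blast
      with P have "latency P \<le> L" using lat ab by (metis order_less_le)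
      moreover have "latency P \<noteq> 0"
        using P(1) by (auto simp: paths_between_def path_end_def latency_def)
      ultimately show ?thesis by simp
    qed
    have "\<not> (real L + 1) ^ h \<le> \<delta> * real N"
      using throughput_bound_of_small_balls[OF design thr _ assms(1) _ lat, where \<delta> = \<delta> and h = h] N \<delta>0 K\<delta>
      by (auto simp: K_def)
    then have "(\<delta> * real N) powr (1 / real h) < ((real L + 1) ^ h) powr (1 / real h)"
      using \<delta>0 N h1 by (intro powr_less_mono2) auto
    also have "\<dots> = real L + 1"
      using h1 by (simp add: powr_powr flip: powr_realpow)
    also have "\<dots> \<le> 2 * real L" using L1 by simp
    finally have lower: "\<delta> powr (1 / real h) * real N powr (1 / real h) < 2 * real L"
      using \<delta>0 by (simp add: powr_mult)
    \<comment> \<open>Both terms are at most \<open>N powr (1 / h)\<close>: the first since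
      \<open>1 / (h + 1) \<le> 1 / h\<close> and \<open>N \<ge> 1\<close>, the second since
      \<open>eps_of r \<le> 1\<close>.\<close>
    have "Lstar r N \<le> real h * (real N powr (1 / real h) + real N powr (1 / real h))"
      unfolding Lstar_def h_def[symmetric] using N h1 eps
      by (intro mult_left_mono add_mono powr_mono powr_mono2) (auto simp: field_simps)
    then have "c * Lstar r N \<le> c * (real h * (real N powr (1 / real h) + real N powr (1 / real h)))"
      using c by (intro mult_left_mono) auto
    also have "\<dots> = \<delta> powr (1 / real h) * real N powr (1 / real h) / 2"
      using h1 by (simp add: c_def)
    also have "\<dots> < real L" using lower by simp
    finally have "c * Lstar r N < real L" .
    moreover have "real L \<le> c * Lstar r N"
      using L1 unfolding L_def by linarith
    ultimately show False by simp
  qed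
  with c show ?thesis by blast
qed

end
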